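(* Let $L,L'$ be two lines in $\mathbb{P}^3$ with $L=H\cap K$ and $L'=H'\cap K'$, where $H,K,H',K'$ are planes. Let $A,B,A',B'$ be the points which correspond to $H,K,H',K'$, respectively, in the dual space, and suppose $A,B,A',B'\notin\Delta_2$. Let $X\subseteq L$ and $X'\subseteq L'$ be two finite sets, each with at least two points, such that $X\cap\Delta_2=\emptyset=X'\cap\Delta_2$ and $X\cap X'=\emptyset$. Suppose $$\operatorname{rank}\left(\begin{pmatrix}A\\ B\\ A'\\ B'\end{pmatrix}\star\begin{pmatrix}P\\ P\\ P'\\ P'\end{pmatrix}\right)>2$$ for all $P\in X$ and all $P'\in X'$. Then $X\star X'=(X\star L')\cap(X'\star L)$ and $|X\star X'|=|X||X'|$.
   Context: Work over an algebraically closed field $\mathbb{K}$; $\mathbb{P}^3$ has coordinates $x_0,\dots,x_3$. For points $P=[p_0:\dots:p_3]$, $Q=[q_0:\dots:q_3]$, the Hadamard product is $P\star Q=[p_0q_0:\dots:p_3q_3]$, defined when not all $p_iq_i$ vanish. For subsets $X,Y\subseteq\mathbb{P}^3$, $X\star Y$ is the Zariski closure of the set of all defined products $P\star Q$ with $P\in X$, $Q\in Y$; in particular for finite $X$ and a line $L'$, $X\star L'=\bigcup_{P\in X}P\star L'$. $\Delta_2$ is the set of points with at least one zero coordinate. The plane $a_0x_0+\dots+a_3x_3=0$ corresponds to the point $[a_0:\dots:a_3]$ of the dual space, and $\Delta_2$ is used in the dual space with the same meaning. In the rank condition, the two $4\times4$ matrices have as rows coordinate vectors of the indicated points, and $\star$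 denotes the entrywise product of matrices (the rank does not depend on the choice of coordinate vectors). *)

theory Defs
  imports "HOL-Analysis.Analysis" "HOL-Computational_Algebra.Polynomial"
begin

text \<open>The index type \<open>4\<close> has the elements \<open>0, 1, 2, 3\<close>, so \<open>x $ 0, \<dots>, x $ 3\<close> are the homogeneous
  coordinates. The product \<open>*\<close> of the library type \<open>'k^4\<close> is entrywise, and hence so is
  \<open>*\<close> on matrices \<open>'k^4^4\<close> (matrix multiplication is \<open>**\<close>).\<close>

definition proj_rel :: "'k::field^4 \<Rightarrow> 'k^4 \<Rightarrow> bool" where
  "proj_rel x y \<longleftrightarrow> x \<noteq> 0 \<and> (\<exists>c. c \<noteq> 0 \<and> y = c *s x)"

lemma part_equivp_proj_rel: "part_equivp (proj_rel :: 'k::field^4 \<Rightarrow> _)"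
proof (rule part_equivpI)
  have "proj_rel (1 :: 'k^4) 1"
    unfolding proj_rel_def by (auto simp: vec_eq_iff intro!: exI[of _ 1])
  then show "\<exists>x :: 'k^4. proj_rel x x" by blast
  show "symp (proj_rel :: 'k^4 \<Rightarrow> _)"
  proof (rule sympI)
    fix x y :: "'k^4"
    assume "proj_rel x y"
    then obtain c where "x \<noteq> 0" "c \<noteq> 0" "y = c *s x"
      unfolding proj_rel_def by blast
    then show "proj_rel y x"
      unfolding proj_rel_def by (auto intro!: exI[of _ "inverse c"])
  qed
  show "transp (proj_rel :: 'k^4 \<Rightarrow> _)"
    unfolding transp_def proj_rel_def by (auto simp: vec.scale_scale)
qed

quotient_type (overloaded) 'k proj3 = "'k::field^4" / partial: proj_rel
  by (rule part_equivp_proj_rel)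

text \<open>A fixed but arbitrary choice of homogeneous coordinates of a point. All notions below are
  invariant under rescaling of the coordinates.\<close>

abbreviation coords :: "'k::field proj3 \<Rightarrow> 'k^4" where
  "coords \<equiv> rep_proj3"

lemma coords_nonzero: "coords P \<noteq> 0"
  using Quotient_rep_reflp[OF Quotient_proj3, of P] by (simp add: proj_rel_def)

lemma coords_abs_proj3:
  assumes "x \<noteq> 0"
  obtains c where "c \<noteq> 0" "coords (abs_proj3 x) = c *s x"
proof -
  have "proj_rel x x"
    unfolding proj_rel_def using assms by (auto intro!: exI[of _ 1])
  then have "proj_rel x (coords (abs_proj3 x))"
    using rep_abs_rsp[OF Quotient3_proj3] by blast
  then show ?thesis
    using that unfolding proj_rel_def by blast
qed

definition is_line :: "'k::field proj3 set \<Rightarrow> bool" where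
  "is_line L \<longleftrightarrow> (\<exists>S. vec.subspace S \<and> vec.dim S = 2 \<and> L = {P. coords P \<in> S})"

text \<open>The plane \<open>a\<^sub>0 x\<^sub>0 + \<dots> + a\<^sub>3 x\<^sub>3 = 0\<close> corresponding to the point \<open>A = [a\<^sub>0 : \<dots> : a\<^sub>3]\<close> of the
  dual space, which is again modelled by \<open>proj3\<close>.\<close>

definition plane_of :: "'k::field proj3 \<Rightarrow> 'k proj3 set" where
  "plane_of A = {P. (\<Sum>i\<in>UNIV. coords A $ i * coords P $ i) = 0}"

definition Delta2 :: "'k::field proj3 set" where
  "Delta2 = {P. \<exists>i. coords P $ i = 0}"

definition homogeneous_form :: "nat \<Rightarrow> ('k::field^4 \<Rightarrow> 'k) \<Rightarrow> bool" where
  "homogeneous_form d F \<longleftrightarrow> (\<exists>c :: (4 \<Rightarrow> nat) \<Rightarrow> 'k. \<forall>x.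
     F x = (\<Sum>e\<in>{e. (\<Sum>i\<in>UNIV. e i) = d}. c e * (\<Prod>i\<in>UNIV. (x $ i) ^ e i)))"

text \<open>The index set of the sum is finite, so the sum is never the default value for infinite sets.\<close>

lemma finite_exponents: "finite {e :: 4 \<Rightarrow> nat. (\<Sum>i\<in>UNIV. e i) = d}"
proof (rule finite_subset)
  show "{e :: 4 \<Rightarrow> nat. (\<Sum>i\<in>UNIV. e i) = d} \<subseteq> PiE UNIV (\<lambda>_. {..d})"
    by (auto intro: member_le_sum)
  show "finite (PiE (UNIV :: 4 set) (\<lambda>_. {..d}))"
    by (rule finite_PiE) auto
qed

definition zariski_closed :: "'k::field proj3 set \<Rightarrow> bool" where
  "zariski_closed Z \<longleftrightarrow>
     (\<exists>\<F>. (\<forall>F\<in>\<F>. \<exists>d. homogeneous_form d F) \<and> Z = {P. \<forall>F\<in>\<F>. F (coords P) = 0})"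

definition zariski_closure :: "'k::field proj3 set \<Rightarrow> 'k proj3 set" where
  "zariski_closure S = \<Inter>{Z. zariski_closed Z \<and> S \<subseteq> Z}"

definition hadamard_defined :: "'k::field proj3 \<Rightarrow> 'k proj3 \<Rightarrow> bool" where
  "hadamard_defined P Q \<longleftrightarrow> coords P * coords Q \<noteq> 0"

text \<open>Only meaningful if \<open>hadamard_defined P Q\<close>.\<close>

definition hadamard_point :: "'k::field proj3 \<Rightarrow> 'k proj3 \<Rightarrow> 'k proj3" where
  "hadamard_point P Q = abs_proj3 (coords P * coords Q)"

definition hadamard :: "'k::field proj3 set \<Rightarrow> 'k proj3 set \<Rightarrow> 'k proj3 set"
    (infixl \<open>\<star>\<close> 75) where
  "X \<star> Y = zariski_closure {hadamard_point P Q | P Q. P \<in> X \<and> Q \<in> Y \<and> hadamard_defined P Q}"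

text \<open>The matrix with the given rows; \<open>vector\<close> places them at the indices \<open>1, 2, 3, 4 = 0\<close>,
  a cyclic shift that does not affect the rank.\<close>

definition matrix_of_rows :: "'k::field^4 \<Rightarrow> 'k^4 \<Rightarrow> 'k^4 \<Rightarrow> 'k^4 \<Rightarrow> 'k^4^4" where
  "matrix_of_rows a b c d = vector [a, b, c, d]"

lemma matrix_of_rows_nth [simp]:
  "matrix_of_rows a b c d $ 1 = a" "matrix_of_rows a b c d $ 2 = b"
  "matrix_of_rows a b c d $ 3 = c" "matrix_of_rows a b c d $ 0 = d"
  unfolding matrix_of_rows_def vector_def by simp_all

end

theory Submission
  imports Defs
begin

text \<open>Both products with a line are unions of lines: \<open>P \<star> L'\<close> is a line for each
  \<open>P \<in> X\<close>, and \<open>P' \<star> L\<close> is a line for each \<open>P' \<in> X'\<close>. Dividing the coefficients of a plane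
  by the coordinates of a point without zero coordinates gives the image of the plane under
  multiplication by that point. Hence \<open>P \<star> L'\<close> and \<open>P' \<star> L\<close> are cut out by four linear forms, and
  after scaling the variables by the coordinates of \<open>P \<star> P'\<close> these are the rows of the matrix in
  the rank condition. Rank greater than 2 thus says that the two lines meet in at most one point
  (\<open>kernel_vectors_proportional\<close>). They do meet in \<open>P \<star> P'\<close>, so their intersection is that point
  (\<open>hadamard_eq_imp_eq\<close>), and taking the union over all \<open>P\<close> and \<open>P'\<close> gives the first claim.

  The number of points comes from the same fact. If \<open>P \<star> P' = Q \<star> Q'\<close>, then this point lies on
  both \<open>Q \<star> L'\<close> and \<open>P' \<star> L\<close>, whose only common point is \<open>Q \<star> P'\<close>. So \<open>P \<star> P' = Q \<star> P'\<close>, and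
  cancelling gives \<open>P = Q\<close> and then \<open>P' = Q'\<close>.

  The closures in the definition of \<open>\<star>\<close> add nothing: a finite union of lines is Zariski closed,
  because products of homogeneous forms are homogeneous, and the set of the points \<open>P \<star> P'\<close> is
  closed as the intersection of two such unions.\<close>

section \<open>Zariski closed sets\<close>

lemma homogeneous_form_zero: "homogeneous_form d (\<lambda>x. 0)"
  unfolding homogeneous_form_def by (intro exI[of _ "\<lambda>_. 0"]) simp

lemma homogeneous_form_add:
  assumes "homogeneous_form d F" "homogeneous_form d G"
  shows "homogeneous_form d (\<lambda>x. F x + G x)"
proof -
  obtain c c' where
    "\<And>x. F x = (\<Sum>e | sum e UNIV = d. c e * (\<Prod>i\<in>UNIV. (x $ i) ^ e i))"
    "\<And>x. G x = (\<Sum>e | sum e UNIV = d. c' e * (\<Prod>i\<in>UNIV. (x $ i) ^ e i))"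
    using assms unfolding homogeneous_form_def by blast
  then show ?thesis
    unfolding homogeneous_form_def
    by (intro exI[of _ "\<lambda>e. c e + c' e"]) (simp add: distrib_right sum.distrib)
qed

lemma homogeneous_form_sum:
  "(\<And>i. i \<in> I \<Longrightarrow> homogeneous_form d (F i)) \<Longrightarrow> homogeneous_form d (\<lambda>x. \<Sum>i\<in>I. F i x)"
  by (induction I rule: infinite_finite_induct)
     (auto intro: homogeneous_form_zero homogeneous_form_add)

lemma homogeneous_form_monomial:
  fixes e :: "4 \<Rightarrow> nat" and a :: "'k::field"
  assumes "sum e UNIV = d"
  shows "homogeneous_form d (\<lambda>x. a * (\<Prod>i\<in>UNIV. (x $ i) ^ e i))"
  unfolding homogeneous_form_def
  using assms finite_exponents[of d]
  by (intro exI[of _ "\<lambda>e'. if e' = e then a else 0"])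
     (simp add: if_distrib[of "\<lambda>t. t * _"] sum.delta cong: if_cong)

lemma homogeneous_form_mult:
  assumes "homogeneous_form d F" "homogeneous_form d' G"
  shows "homogeneous_form (d + d') (\<lambda>x. F x * G x)"
proof -
  obtain c c' where
    F: "\<And>x. F x = (\<Sum>e | sum e UNIV = d. c e * (\<Prod>i\<in>UNIV. (x $ i) ^ e i))" and
    G: "\<And>x. G x = (\<Sum>e | sum e UNIV = d'. c' e * (\<Prod>i\<in>UNIV. (x $ i) ^ e i))"
    using assms unfolding homogeneous_form_def by blast
  have "F x * G x = (\<Sum>e | sum e UNIV = d. \<Sum>e' | sum e' UNIV = d'.
      (c e * c' e') * (\<Prod>i\<in>UNIV. (x $ i) ^ (e i + e' i)))" for x
    unfolding F G sum_product by (simp add: power_add prod.distrib mult_ac)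
  moreover have "homogeneous_form (d + d') (\<lambda>x. \<Sum>e | sum e UNIV = d. \<Sum>e' | sum e' UNIV = d'.
      (c e * c' e') * (\<Prod>i\<in>UNIV. (x $ i) ^ (e i + e' i)))"
    by (intro homogeneous_form_sum homogeneous_form_monomial) (auto simp: sum.distrib)
  ultimately show ?thesis
    by simp
qed

lemma homogeneous_form_linear:
  fixes a :: "'k::field^4"
  shows "homogeneous_form 1 (\<lambda>x. \<Sum>i\<in>UNIV. a $ i * x $ i)"
proof (rule homogeneous_form_sum)
  fix i :: 4
  have "(\<Prod>j\<in>UNIV. (x $ j) ^ (if j = i then 1 else 0)) = x $ i" for x :: "'k^4"
    by (simp add: if_distrib[of "\<lambda>n. _ ^ n"] prod.delta cong: if_cong)
  then show "homogeneous_form 1 (\<lambda>x. a $ i * x $ i)"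
    using homogeneous_form_monomial[of "\<lambda>j. if j = i then 1 else 0" 1 "a $ i"] by simp
qed

lemma zariski_closed_linear: "zariski_closed {P. (\<Sum>i\<in>UNIV. a $ i * coords P $ i) = 0}"
  unfolding zariski_closed_def
  using homogeneous_form_linear[of a]
  by (intro exI[of _ "{\<lambda>x. \<Sum>i\<in>UNIV. a $ i * x $ i}"]) auto

lemma zariski_closed_empty: "zariski_closed ({} :: 'k::field proj3 set)"
proof -
  have "homogeneous_form 0 (\<lambda>x :: 'k^4. 1 :: 'k)"
    using homogeneous_form_monomial[of "\<lambda>_. 0" 0 1] by simp
  then show ?thesis
    unfolding zariski_closed_def by (intro exI[of _ "{\<lambda>x. 1}"]) auto
qed

lemma zariski_closed_Int:
  assumes "zariski_closed Y" "zariski_closed Z"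
  shows "zariski_closed (Y \<inter> Z)"
proof -
  obtain \<F> \<G> where "\<forall>F\<in>\<F>. \<exists>d. homogeneous_form d F" "Y = {P. \<forall>F\<in>\<F>. F (coords P) = 0}"
    "\<forall>F\<in>\<G>. \<exists>d. homogeneous_form d F" "Z = {P. \<forall>F\<in>\<G>. F (coords P) = 0}"
    using assms unfolding zariski_closed_def by blast
  then show ?thesis
    unfolding zariski_closed_def by (intro exI[of _ "\<F> \<union> \<G>"]) auto
qed

lemma zariski_closed_Un:
  assumes "zariski_closed Y" "zariski_closed Z"
  shows "zariski_closed (Y \<union> Z)"
proof -
  obtain \<F> \<G> where F: "\<forall>F\<in>\<F>. \<exists>d. homogeneous_form d F" "Y = {P. \<forall>F\<in>\<F>. F (coords P) = 0}"
    and G: "\<forall>G\<in>\<G>. \<exists>d. homogeneous_form d G" "Z = {P. \<forall>G\<in>\<G>. G (coords P) = 0}"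
    using assms unfolding zariski_closed_def by blast
  let ?FG = "{\<lambda>x. F x * G x | F G. F \<in> \<F> \<and> G \<in> \<G>}"
  have "\<forall>H\<in>?FG. \<exists>d. homogeneous_form d H"
    using F(1) G(1) homogeneous_form_mult by blast
  moreover have "Y \<union> Z = {P. \<forall>H\<in>?FG. H (coords P) = 0}"
    unfolding F(2) G(2) by (auto; metis mult_eq_0_iff)
  ultimately show ?thesis
    unfolding zariski_closed_def by blast
qed

lemma zariski_closed_UN:
  "finite I \<Longrightarrow> (\<And>i. i \<in> I \<Longrightarrow> zariski_closed (Z i)) \<Longrightarrow> zariski_closed (\<Union>i\<in>I. Z i)"
  by (induction I rule: finite_induct) (auto intro: zariski_closed_empty zariski_closed_Un)

lemma zariski_closure_eq: "zariski_closed S \<Longrightarrow> zariski_closure S = S"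
  unfolding zariski_closure_def by blast

section \<open>Multiplication by a point without zero coordinates\<close>

lemma proj3_eqI:
  assumes "coords P = c *s coords Q"
  shows "P = Q"
proof -
  have "c \<noteq> 0"
    using assms coords_nonzero[of P] by auto
  then have "proj_rel (coords Q) (coords P)"
    unfolding proj_rel_def using assms coords_nonzero by blast
  then show ?thesis
    using Quotient_rel_rep[OF Quotient_proj3] by metis
qed

lemma coords_nth_nonzero: "P \<notin> Delta2 \<Longrightarrow> coords P $ i \<noteq> 0"
  unfolding Delta2_def by blast

lemma hadamard_defined_if_notin_Delta2:
  assumes "P \<notin> Delta2"
  shows "hadamard_defined P Q"
  unfolding hadamard_defined_def
  using coords_nth_nonzero[OF assms] coords_nonzero[of Q] by (auto simp: vec_eq_iff)

lemma coords_hadamard_point: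
  assumes "P \<notin> Delta2"
  obtains c where "c \<noteq> 0" "coords (hadamard_point P Q) = c *s (coords P * coords Q)"
  using coords_abs_proj3 hadamard_defined_if_notin_Delta2[OF assms, of Q]
  unfolding hadamard_defined_def hadamard_point_def by blast

lemma hadamard_point_commute: "hadamard_point P Q = hadamard_point Q P"
  unfolding hadamard_point_def by (simp add: mult.commute)

lemma hadamard_point_eqD:
  assumes "hadamard_point P Q = hadamard_point R S" "P \<notin> Delta2" "R \<notin> Delta2"
  obtains c where "\<And>i. coords P $ i * coords Q $ i = c * (coords R $ i * coords S $ i)"
proof -
  obtain a b where ab: "a \<noteq> 0" "coords (hadamard_point P Q) = a *s (coords P * coords Q)"
    "coords (hadamard_point P Q) = b *s (coords R * coords S)"
    using assms coords_hadamard_point by metis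
  then have "a * (coords P $ i * coords Q $ i) = b * (coords R $ i * coords S $ i)" for i
    by (metis vector_mult_component vector_smult_component)
  then have "coords P $ i * coords Q $ i = (b / a) * (coords R $ i * coords S $ i)" for i
    using ab(1) by (simp add: field_simps)
  then show ?thesis
    by (rule that)
qed

lemma inj_hadamard_point:
  assumes "P \<notin> Delta2"
  shows "inj (hadamard_point P)"
proof (rule injI)
  fix Q R assume "hadamard_point P Q = hadamard_point P R"
  then obtain c where "\<And>i. coords P $ i * coords Q $ i = c * (coords P $ i * coords R $ i)"
    using hadamard_point_eqD assms by blast
  then have "coords Q = c *s coords R"
    using coords_nth_nonzero[OF assms] by (auto simp: vec_eq_iff mult.left_commute)
  then show "Q = R"
    by (rule proj3_eqI)
qed

lemma hadamard_point_image_plane: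
  assumes P: "P \<notin> Delta2"
  shows "hadamard_point P ` plane_of A
    = {Z. (\<Sum>i\<in>UNIV. (\<chi> i. coords A $ i / coords P $ i) $ i * coords Z $ i) = 0}"
proof (intro equalityI subsetI)
  fix Z assume "Z \<in> hadamard_point P ` plane_of A"
  then obtain Q where Q: "Z = hadamard_point P Q" "(\<Sum>i\<in>UNIV. coords A $ i * coords Q $ i) = 0"
    unfolding plane_of_def by blast
  obtain c where c: "coords Z = c *s (coords P * coords Q)"
    using Q(1) coords_hadamard_point[OF P] by metis
  have "(\<Sum>i\<in>UNIV. coords A $ i / coords P $ i * coords Z $ i)
      = c * (\<Sum>i\<in>UNIV. coords A $ i * coords Q $ i)"
    unfolding c sum_distrib_left using coords_nth_nonzero[OF P]
    by (intro sum.cong) (auto simp: field_simps)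
  then show "Z \<in> {Z. (\<Sum>i\<in>UNIV. (\<chi> i. coords A $ i / coords P $ i) $ i * coords Z $ i) = 0}"
    using Q(2) by simp
next
  fix Z assume "Z \<in> {Z. (\<Sum>i\<in>UNIV. (\<chi> i. coords A $ i / coords P $ i) $ i * coords Z $ i) = 0}"
  then have Z: "(\<Sum>i\<in>UNIV. coords A $ i / coords P $ i * coords Z $ i) = 0"
    by simp
  define q where "q = (\<chi> i. coords Z $ i / coords P $ i)"
  have "q \<noteq> 0"
    using coords_nonzero[of Z] coords_nth_nonzero[OF P] by (auto simp: q_def vec_eq_iff)
  then obtain c where c: "c \<noteq> 0" "coords (abs_proj3 q) = c *s q"
    using coords_abs_proj3 by blast
  obtain b where b: "coords (hadamard_point P (abs_proj3 q)) = b *s (coords P * (c *s q))"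
    using coords_hadamard_point[OF P] c(2) by metis
  have "coords (hadamard_point P (abs_proj3 q)) = (b * c) *s coords Z"
    unfolding b using coords_nth_nonzero[OF P] by (simp add: q_def vec_eq_iff)
  then have "Z = hadamard_point P (abs_proj3 q)"
    by (metis proj3_eqI)
  moreover have "(\<Sum>i\<in>UNIV. coords A $ i * coords (abs_proj3 q) $ i)
      = c * (\<Sum>i\<in>UNIV. coords A $ i / coords P $ i * coords Z $ i)"
    unfolding c(2) sum_distrib_left by (intro sum.cong) (auto simp: q_def)
  ultimately show "Z \<in> hadamard_point P ` plane_of A"
    unfolding plane_of_def using Z by auto
qed

lemma zariski_closed_hadamard_point_image:
  assumes "P \<notin> Delta2"
  shows "zariski_closed (hadamard_point P ` (plane_of A \<inter> plane_of B))"
  unfolding image_Int[OF inj_hadamard_point[OF assms]] hadamard_point_image_plane[OF assms]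
  by (intro zariski_closed_Int zariski_closed_linear)

section \<open>The rank condition\<close>

text \<open>If \<open>u\<close> is not a multiple of \<open>w\<close>, then being orthogonal to \<open>w\<close> and then also to \<open>u\<close>
  lowers the dimension strictly each time. The row space lies in the resulting subspace, so the
  rank is at most the number of columns minus 2.\<close>

lemma kernel_vectors_proportional:
  fixes M :: "'k::field^'n^'m"
  assumes rank: "rank M + 2 > CARD('n)"
    and u: "\<And>r. (\<Sum>i\<in>UNIV. M $ r $ i * u $ i) = 0"
    and w: "\<And>r. (\<Sum>i\<in>UNIV. M $ r $ i * w $ i) = 0" "w \<noteq> 0"
  obtains c where "u = c *s w"
proof -
  define T where "T = {x :: 'k^'n. (\<Sum>i\<in>UNIV. x $ i * w $ i) = 0}"
  define S where "S = {x \<in> T. (\<Sum>i\<in>UNIV. x $ i * u $ i) = 0}"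
  have T: "vec.subspace T" unfolding T_def
    by (rule vec.subspaceI)
       (simp_all add: distrib_right sum.distrib mult.assoc flip: sum_distrib_left)
  have S: "vec.subspace S" unfolding S_def
    using T by (intro vec.subspaceI)
       (simp_all add: distrib_right sum.distrib mult.assoc vec.subspace_0 vec.subspace_add
          vec.subspace_scale flip: sum_distrib_left)
  obtain i where i: "w $ i \<noteq> 0"
    using w(2) by (auto simp: vec_eq_iff)
  have delta: "(\<Sum>k\<in>UNIV. axis j a $ k * v $ k) = a * v $ j" for j a and v :: "'k^'n"
    by (simp add: axis_def if_distrib[of "\<lambda>t. t * _"] sum.delta cong: if_cong)
  have "axis i 1 \<notin> T"
    unfolding T_def using i by (simp add: delta)
  then have "T \<subset> UNIV"
    by blast
  then have T_less: "vec.dim T < CARD('n)"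
    using vec.dim_psubset[of T UNIV] T by (simp add: vec.span_eq_iff[THEN iffD2] card_cart_basis)
  have "\<forall>j. u $ j * w $ i = u $ i * w $ j"
  proof (rule ccontr)
    assume "\<not> ?thesis"
    then obtain j where j: "u $ j * w $ i \<noteq> u $ i * w $ j"
      by blast
    \<comment> \<open>Orthogonal to \<open>w\<close> but not to \<open>u\<close>.\<close>
    define x where "x = axis j (w $ i) - axis i (w $ j)"
    have x: "(\<Sum>k\<in>UNIV. x $ k * v $ k) = w $ i * v $ j - w $ j * v $ i" for v :: "'k^'n"
      by (simp add: x_def left_diff_distrib sum_subtractf delta)
    have "x \<in> T - S"
      using j unfolding S_def T_def Diff_iff mem_Collect_eq x by (simp add: mult.commute)
    then have "S \<subset> T"
      unfolding S_def by blast
    then have "vec.dim S < vec.dim T"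
      using vec.dim_psubset[of S T] S T by (simp add: vec.span_eq_iff[THEN iffD2])
    moreover have "rows M \<subseteq> S"
      using u w(1) by (auto simp: rows_def row_def S_def T_def)
    then have "rank M \<le> vec.dim S"
      unfolding row_rank_def_gen by (rule vec.dim_subset)
    ultimately show False
      using rank T_less by linarith
  qed
  then have "u = (u $ i / w $ i) *s w"
    using i by (simp add: vec_eq_iff field_simps)
  then show ?thesis
    by (rule that)
qed

text \<open>With \<open>L = plane_of A \<inter> plane_of B\<close> and \<open>L' = plane_of A' \<inter> plane_of B'\<close>, the lines
  \<open>P \<star> L'\<close> and \<open>P' \<star> L\<close> meet only in \<open>P \<star> P'\<close>. A second common point would give the matrix
  two kernel vectors that are not proportional.\<close>

lemma hadamard_eq_imp_eq:
  fixes A B A' B' P P' :: "'k::field proj3"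
  assumes rank: "rank (matrix_of_rows (coords A) (coords B) (coords A') (coords B')
      * matrix_of_rows (coords P) (coords P) (coords P') (coords P')) > 2"
    and P: "P \<notin> Delta2" "P \<in> plane_of A \<inter> plane_of B"
    and P': "P' \<notin> Delta2" "P' \<in> plane_of A' \<inter> plane_of B'"
    and Q: "Q \<in> plane_of A \<inter> plane_of B"
    and Q': "Q' \<in> plane_of A' \<inter> plane_of B'"
    and eq: "hadamard_point P Q' = hadamard_point P' Q"
  shows "Q' = P'"
proof -
  let ?M = "matrix_of_rows (coords A) (coords B) (coords A') (coords B')
      * matrix_of_rows (coords P) (coords P) (coords P') (coords P')"
  obtain c where c: "\<And>i. coords P $ i * coords Q' $ i = c * (coords P' $ i * coords Q $ i)"
    using hadamard_point_eqD[OF eq P(1) P'(1)] by blast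
  \<comment> \<open>In the scaled variables of the matrix, the all-ones vector stands for \<open>P \<star> P'\<close> and \<open>v\<close>
    for \<open>P \<star> Q' = P' \<star> Q\<close>.\<close>
  define v where "v = (\<chi> i. coords Q' $ i / coords P' $ i)"
  have v1: "a * coords P' $ i * v $ i = a * coords Q' $ i" for a i
    using coords_nth_nonzero[OF P'(1)] by (simp add: v_def)
  have v2: "a * coords P $ i * v $ i = c * (a * coords Q $ i)" for a i
    using coords_nth_nonzero[OF P'(1)] c[of i] by (simp add: v_def field_simps)
  have cases: "(\<forall>r::4. R r) \<longleftrightarrow> R 1 \<and> R 2 \<and> R 3 \<and> R 0" for R
  proof -
    have "(4 :: 4) = 0"
      by simp
    then show ?thesis
      using forall_4[of R] by metis
  qed
  have "\<forall>r. (\<Sum>i\<in>UNIV. ?M $ r $ i * v $ i) = 0"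
    unfolding cases using Q Q' by (simp add: v1 v2 plane_of_def flip: sum_distrib_left)
  moreover have "\<forall>r. (\<Sum>i\<in>UNIV. ?M $ r $ i * (1 :: 'k^4) $ i) = 0"
    unfolding cases using P(2) P'(2) by (simp add: plane_of_def)
  moreover have "(1 :: 'k^4) \<noteq> 0"
    by (simp add: vec_eq_iff)
  ultimately obtain k where "v = k *s 1"
    using kernel_vectors_proportional[of ?M v 1] rank by auto
  then have "coords Q' = k *s coords P'"
    using coords_nth_nonzero[OF P'(1)] by (simp add: v_def vec_eq_iff field_simps)
  then show "Q' = P'"
    by (rule proj3_eqI)
qed

section \<open>The intersection and the number of points\<close>

lemma hadamard_eq_UN:
  assumes "X \<inter> Delta2 = {}" "zariski_closed (\<Union>P\<in>X. hadamard_point P ` Y)"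
  shows "X \<star> Y = (\<Union>P\<in>X. hadamard_point P ` Y)"
proof -
  have "{hadamard_point P Q | P Q. P \<in> X \<and> Q \<in> Y \<and> hadamard_defined P Q}
      = (\<Union>P\<in>X. hadamard_point P ` Y)"
    using assms(1) hadamard_defined_if_notin_Delta2 by fastforce
  then show ?thesis
    unfolding hadamard_def using zariski_closure_eq[OF assms(2)] by simp
qed

theorem theorem4p2:
  fixes L L' H K H' K' X X' :: "'k::alg_closed_field proj3 set"
    and A B A' B' :: "'k proj3"
  assumes "is_line L" and "is_line L'"
    and "L = H \<inter> K" and "L' = H' \<inter> K'"
    and "H = plane_of A" and "K = plane_of B"
    and "H' = plane_of A'" and "K' = plane_of B'"
    and "A \<notin> Delta2" and "B \<notin> Delta2" and "A' \<notin> Delta2" and "B' \<notin> Delta2"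
    and "finite X" and "finite X'"
    and "X \<subseteq> L" and "X' \<subseteq> L'"
    and "card X \<ge> 2" and "card X' \<ge> 2"
    and "X \<inter> Delta2 = {}" and "X' \<inter> Delta2 = {}"
    and "X \<inter> X' = {}"
    and "\<forall>P\<in>X. \<forall>P'\<in>X'.
      rank (matrix_of_rows (coords A) (coords B) (coords A') (coords B')
            * matrix_of_rows (coords P) (coords P) (coords P') (coords P')) > 2"
  shows "X \<star> X' = (X \<star> L') \<inter> (X' \<star> L) \<and> card (X \<star> X') = card X * card X'"
proof -
  have P: "P \<notin> Delta2" "P \<in> plane_of A \<inter> plane_of B" if "P \<in> X" for P
    using that assms by auto
  have P': "P' \<notin> Delta2" "P' \<in> plane_of A' \<inter> plane_of B'" if "P' \<in> X'" for P'
    using that assms by auto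
  have L: "L = plane_of A \<inter> plane_of B" "L' = plane_of A' \<inter> plane_of B'"
    using assms by auto
  have meet: "Q' = P'" if "P \<in> X" "P' \<in> X'" "Q \<in> L" "Q' \<in> L'"
    "hadamard_point P Q' = hadamard_point P' Q" for P P' Q Q'
    using that P P' L assms(22) by (intro hadamard_eq_imp_eq[of A B A' B' P P' Q Q']) auto
  let ?XX' = "\<Union>P\<in>X. hadamard_point P ` X'"
  let ?XL' = "\<Union>P\<in>X. hadamard_point P ` L'"
  let ?X'L = "\<Union>P'\<in>X'. hadamard_point P' ` L"
  have closed: "zariski_closed ?XL'" "zariski_closed ?X'L"
    unfolding L using P P' assms(13,14)
    by (auto intro!: zariski_closed_UN zariski_closed_hadamard_point_image)
  have int: "?XX' = ?XL' \<inter> ?X'L"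
  proof (intro equalityI subsetI)
    fix Z assume "Z \<in> ?XX'"
    then show "Z \<in> ?XL' \<inter> ?X'L"
      using assms(15,16) hadamard_point_commute by blast
  next
    fix Z assume "Z \<in> ?XL' \<inter> ?X'L"
    then show "Z \<in> ?XX'"
      using meet by blast
  qed
  then have XX': "X \<star> X' = ?XX'"
    using zariski_closed_Int[OF closed] by (intro hadamard_eq_UN assms(19)) simp
  have "X \<star> X' = (X \<star> L') \<inter> (X' \<star> L)"
    unfolding XX' hadamard_eq_UN[OF assms(19) closed(1)] hadamard_eq_UN[OF assms(20) closed(2)]
    by (rule int)
  moreover have "inj_on (\<lambda>(P, P'). hadamard_point P P') (X \<times> X')"
  proof (clarsimp simp: inj_on_def)
    fix P P' Q Q'
    assume *: "P \<in> X" "P' \<in> X'" "Q \<in> X" "Q' \<in> X'" "hadamard_point P P' = hadamard_point Q Q'"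
    \<comment> \<open>This point lies on both \<open>Q \<star> L'\<close> and \<open>P' \<star> L\<close>.\<close>
    have "Q' = P'"
      using * assms(15,16) hadamard_point_commute[of P P'] by (intro meet[of Q P' P Q']) auto
    then have "hadamard_point P' P = hadamard_point P' Q"
      using * hadamard_point_commute by metis
    then show "P = Q \<and> P' = Q'"
      using \<open>Q' = P'\<close> injD[OF inj_hadamard_point[OF P'(1)]] * by blast
  qed
  then have "card ((\<lambda>(P, P'). hadamard_point P P') ` (X \<times> X')) = card X * card X'"
    by (simp add: card_image card_cartesian_product)
  moreover have "(\<lambda>(P, P'). hadamard_point P P') ` (X \<times> X') = X \<star> X'"
    unfolding XX' by auto
  ultimately show ?thesis
    by simp
qed

end
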